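(* Let $A,M,B,R,P_*$ be as in the context, and suppose that $\|I-M^{-1}A\|_B<1$, that $M^{-1}A$ is $B$-normal, and that $I-M^{-1}A$ is nonsingular. Let $\Pi_A(P_*,R)$ be a $B$-orthogonal projection with $0<\dim\mathcal R(\Pi_A(P_*,R))=n_c<n$, and let $\nu\in\mathbb{N}$. Then $$\|E^{\nu,\nu}\|_B=\|E^{\nu,0}\|_B^2=\|E^{0,\nu}\|_B^2=1-\frac1{K_{\widehat X,B}(P_* )},$$ where $\widehat X=B\bigl(I-(I-\widehat M^{-1}B)^\nu\bigr)^{-1}$ is Hermitian positive definite and $1/K_{\widehat X,B}(P_* )\in(0,1)$.
   Context: $A\in\mathbb{C}^{n\times n}$ is nonsingular, $M^{-1}\in\mathbb{C}^{n\times n}$ is nonsingular, and $B\in\mathbb{C}^{n\times n}$ is Hermitian positive definite (HPD). $\|x\|_B=\sqrt{x^HBx}$ and $\|C\|_B=\sup_{x\ne0}\|Cx\|_B/\|x\|_B$. The $B$-adjoint of $C\in\mathbb{C}^{n\times n}$ is $C^+=B^{-1}C^HB$; $C$ is $B$-normal if $CC^+=C^+C$ and $B$-orthogonal if $C^+=C$. $\mathcal R(\cdot)$ denotes the range. $\mathbb{N}=\{1,2,\dots\}$. $R\in\mathbb{C}^{n\times n_c}$ has full column rank and $P_*=B^{-1}A^HR$. $\Pi_A(P_*,R)=P_*(R^HAP_* )^{-1}R^HA$. The error propagation matrices are, for $\nu_1,\nu_2\in\mathbb{N}_0$, $$E^{\nu_1,\nu_2}=(I-M^{-1}A)^{\nu_2}(I-\Pi_A(P_*,R))(I-M^{-1}A)^{\nu_1}.$$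 The matrix $\widehat M^{-1}$ is defined by $\widehat M^{-1}=M^{-1}AB^{-1}+B^{-1}A^HM^{-H}-M^{-1}AB^{-1}A^HM^{-H}$, so that $I-\widehat M^{-1}B=(I-M^{-1}A)(I-M^{-1}A)^+$. For HPD matrices $G,C\in\mathbb{C}^{n\times n}$ and $P\in\mathbb{C}^{n\times n_c}$ of full column rank, $$K_{G,C}(P)=\max_{v\in\mathbb{C}^n\setminus\{0\}}\frac{v^HG\bigl(I-P(P^HGP)^{-1}P^HG\bigr)v}{v^HCv}.$$ *)

theory Defs
  imports "HOL-Analysis.Analysis"
begin

text \<open>Products, powers and the unit of the type \<open>complex ^ 'n ^ 'n\<close> inherited from the ring classes are
  componentwise, so the matrix product is always \<open>**\<close>, the identity is \<open>mat 1\<close>, and powers are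
  given by \<open>matpow\<close>.\<close>

primrec matpow :: "complex ^ 'n ^ 'n \<Rightarrow> nat \<Rightarrow> complex ^ 'n ^ 'n" where
  "matpow C 0 = mat 1"
| "matpow C (Suc k) = C ** matpow C k"

definition ctranspose :: "complex ^ 'n ^ 'm \<Rightarrow> complex ^ 'm ^ 'n" where
  "ctranspose C = transpose (map_matrix cnj C)"

definition cdot :: "complex ^ 'n \<Rightarrow> complex ^ 'n \<Rightarrow> complex" where
  "cdot x y = (\<Sum>i\<in>UNIV. cnj (x $ i) * y $ i)"

text \<open>The form \<open>v\<^sup>H C v\<close> is real whenever \<open>C\<close> is Hermitian, which is the case at every use below;
  taking the real part only converts its type from complex to real.\<close>

definition qform :: "complex ^ 'n ^ 'n \<Rightarrow> complex ^ 'n \<Rightarrow> real" where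
  "qform C v = Re (cdot v (C *v v))"

definition hpd :: "complex ^ 'n ^ 'n \<Rightarrow> bool" where
  "hpd C \<longleftrightarrow> ctranspose C = C \<and> (\<forall>v. v \<noteq> 0 \<longrightarrow> 0 < qform C v)"

definition bnorm_vec :: "complex ^ 'n ^ 'n \<Rightarrow> complex ^ 'n \<Rightarrow> real" where
  "bnorm_vec B x = sqrt (qform B x)"

definition bnorm :: "complex ^ 'n ^ 'n \<Rightarrow> complex ^ 'n ^ 'n \<Rightarrow> real" where
  "bnorm B C = (SUP x\<in>{x. x \<noteq> 0}. bnorm_vec B (C *v x) / bnorm_vec B x)"

definition badjoint :: "complex ^ 'n ^ 'n \<Rightarrow> complex ^ 'n ^ 'n \<Rightarrow> complex ^ 'n ^ 'n" where
  "badjoint B C = matrix_inv B ** ctranspose C ** B"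

definition bnormal :: "complex ^ 'n ^ 'n \<Rightarrow> complex ^ 'n ^ 'n \<Rightarrow> bool" where
  "bnormal B C \<longleftrightarrow> C ** badjoint B C = badjoint B C ** C"

definition borthogonal :: "complex ^ 'n ^ 'n \<Rightarrow> complex ^ 'n ^ 'n \<Rightarrow> bool" where
  "borthogonal B C \<longleftrightarrow> badjoint B C = C"

definition Pstar ::
  "complex ^ 'n ^ 'n \<Rightarrow> complex ^ 'n ^ 'n \<Rightarrow> complex ^ 'm ^ 'n \<Rightarrow> complex ^ 'm ^ 'n" where
  "Pstar A B R = matrix_inv B ** ctranspose A ** R"

definition cgproj ::
  "complex ^ 'n ^ 'n \<Rightarrow> complex ^ 'm ^ 'n \<Rightarrow> complex ^ 'm ^ 'n \<Rightarrow> complex ^ 'n ^ 'n" where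
  "cgproj A P R = P ** matrix_inv (ctranspose R ** A ** P) ** ctranspose R ** A"

definition smoother :: "complex ^ 'n ^ 'n \<Rightarrow> complex ^ 'n ^ 'n \<Rightarrow> complex ^ 'n ^ 'n" where
  "smoother A M = mat 1 - matrix_inv M ** A"

definition errprop ::
  "complex ^ 'n ^ 'n \<Rightarrow> complex ^ 'n ^ 'n \<Rightarrow> complex ^ 'n ^ 'n \<Rightarrow> complex ^ 'm ^ 'n \<Rightarrow> nat \<Rightarrow> nat
    \<Rightarrow> complex ^ 'n ^ 'n" where
  "errprop A M B R \<nu>1 \<nu>2 =
     matpow (smoother A M) \<nu>2 ** (mat 1 - cgproj A (Pstar A B R) R) ** matpow (smoother A M) \<nu>1"

text \<open>The matrix written \<open>M\<close>-hat to the power \<open>-1\<close>. It is a name for the right-hand side, not the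
  inverse of another matrix.\<close>

definition Mhat_inv ::
  "complex ^ 'n ^ 'n \<Rightarrow> complex ^ 'n ^ 'n \<Rightarrow> complex ^ 'n ^ 'n \<Rightarrow> complex ^ 'n ^ 'n" where
  "Mhat_inv A M B =
     matrix_inv M ** A ** matrix_inv B
     + matrix_inv B ** ctranspose A ** ctranspose (matrix_inv M)
     - matrix_inv M ** A ** matrix_inv B ** ctranspose A ** ctranspose (matrix_inv M)"

definition Xhat ::
  "complex ^ 'n ^ 'n \<Rightarrow> complex ^ 'n ^ 'n \<Rightarrow> complex ^ 'n ^ 'n \<Rightarrow> nat \<Rightarrow> complex ^ 'n ^ 'n" where
  "Xhat A M B \<nu> = B ** matrix_inv (mat 1 - matpow (mat 1 - Mhat_inv A M B ** B) \<nu>)"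

text \<open>\<open>Greatest\<close> is a genuine maximum: it is specified only if the maximum is attained.\<close>

definition Kconst ::
  "complex ^ 'n ^ 'n \<Rightarrow> complex ^ 'n ^ 'n \<Rightarrow> complex ^ 'm ^ 'n \<Rightarrow> real" where
  "Kconst G C P =
     (GREATEST k. k \<in> {qform (G ** (mat 1 - P ** matrix_inv (ctranspose P ** G ** P)
                                      ** ctranspose P ** G)) v / qform C v | v. v \<noteq> 0})"

end

theory Submission
  imports Defs
begin

text \<open>
  Everything takes place in the inner product \<open>\<langle>x, y\<rangle> = Re (x\<^sup>H B y)\<close>, called \<open>bform B\<close>, in which
  \<open>badjoint B\<close> is the adjoint; the real part determines all norms and satisfies
  Cauchy-Schwarz and the adjoint relation. Let \<open>S = I - M\<^sup>-\<^sup>1 A\<close>, let \<open>T\<close> be its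
  \<open>\<nu>\<close>-th power and \<open>Q = I - Pr\<close>, where \<open>Pr\<close> is the coarse-grid projection. Then the three error
  propagators are \<open>T Q T\<close>, \<open>Q T\<close> and \<open>T Q\<close>, where \<open>T\<close> is normal and \<open>Q\<close> is an orthogonal projection.

  The first two equalities hold for every normal \<open>T\<close> and orthogonal projection \<open>Q\<close>. The vectors \<open>T y\<close> and
  \<open>T\<^sup>+ y\<close> have equal length, so a left factor \<open>T\<close> may be replaced by \<open>T\<^sup>+\<close> inside a norm. This turns
  \<open>T Q\<close> into \<open>T\<^sup>+ Q = (Q T)\<^sup>+\<close> and \<open>T Q T\<close> into \<open>T\<^sup>+ Q T = (Q T)\<^sup>+ (Q T)\<close>, and the identities
  \<open>\<parallel>C\<^sup>+\<parallel> = \<parallel>C\<parallel>\<close> and \<open>\<parallel>C\<^sup>+ C\<parallel> = \<parallel>C\<parallel>\<^sup>2\<close> finish the argument (\<open>bnorm_normal_projection\<close>).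

  For the value of the norm, let \<open>\<mu>\<close> be the maximum of \<open>\<parallel>T y\<parallel>\<^sup>2 / \<parallel>y\<parallel>\<^sup>2\<close> over nonzero \<open>y\<close> in the range of
  \<open>Q\<close>, which is the orthogonal complement of the range of \<open>P\<^sub>*\<close>; it is attained by compactness, and
  \<open>\<parallel>T Q\<parallel>\<^sup>2 = \<mu>\<close>. Here \<open>0 < \<mu>\<close> as \<open>T\<close> is nonsingular, and \<open>\<mu> < 1\<close> as \<open>S\<close> is a strict contraction.
  With \<open>W = I - T T\<^sup>+\<close> one has \<open>\<langle>y, W y\<rangle> = \<parallel>y\<parallel>\<^sup>2 - \<parallel>T y\<parallel>\<^sup>2\<close>, so \<open>1 - \<mu>\<close> is the minimum of the Rayleigh
  quotient of \<open>W\<close> on that complement. Moreover \<open>T T\<^sup>+\<close> is the \<open>\<nu>\<close>-th power of \<open>S S\<^sup>+\<close> by normality,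
  so \<open>B W\<^sup>-\<^sup>1\<close> is the matrix \<open>Xhat\<close>.
  It remains that the approximation constant of \<open>B W\<^sup>-\<^sup>1\<close> is the reciprocal
  of this minimum, a duality proved in \<open>Kconst_eq_inverse_min\<close> by two applications of Cauchy-Schwarz,
  one for \<open>B\<close> and one for \<open>B W\<^sup>-\<^sup>1\<close>.
\<close>

section \<open>Matrices over the complex numbers\<close>

lemma ctranspose_nth [simp]: "ctranspose C $ i $ j = cnj (C $ j $ i)"
  by (simp add: ctranspose_def transpose_def)

lemma ctranspose_mult: "ctranspose (A ** B) = ctranspose B ** ctranspose A"
  by (simp add: vec_eq_iff matrix_matrix_mult_def mult.commute)

lemma ctranspose_ctranspose [simp]: "ctranspose (ctranspose C) = C"
  by (simp add: vec_eq_iff)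

lemma ctranspose_mat_1 [simp]: "ctranspose (mat 1) = mat 1"
  by (simp add: vec_eq_iff mat_def)

lemma ctranspose_diff: "ctranspose (C - D) = ctranspose C - ctranspose D"
  by (simp add: vec_eq_iff)

lemma cdot_mult_right: "cdot x (C *v y) = cdot (ctranspose C *v x) y"
proof -
  have "cdot x (C *v y) = (\<Sum>i\<in>UNIV. \<Sum>j\<in>UNIV. cnj (x $ i) * (C $ i $ j * y $ j))"
    by (simp add: cdot_def matrix_vector_mult_def sum_distrib_left)
  also have "\<dots> = (\<Sum>j\<in>UNIV. \<Sum>i\<in>UNIV. cnj (x $ i) * (C $ i $ j * y $ j))"
    by (rule sum.swap)
  also have "\<dots> = cdot (ctranspose C *v x) y"
    by (simp add: cdot_def matrix_vector_mult_def sum_distrib_left mult_ac)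
  finally show ?thesis .
qed

lemma cdot_simps [simp]:
  "cdot 0 y = 0" "cdot x 0 = 0"
  "cdot (x + x') y = cdot x y + cdot x' y" "cdot x (y + y') = cdot x y + cdot x y'"
  "cdot (x - x') y = cdot x y - cdot x' y" "cdot x (y - y') = cdot x y - cdot x y'"
  "cdot (r *\<^sub>R x) y = r *\<^sub>R cdot x y" "cdot x (r *\<^sub>R y) = r *\<^sub>R cdot x y"
  by (simp_all add: cdot_def algebra_simps sum.distrib sum_subtractf scaleR_sum_right
      del: cnj_sum)

lemma matrix_vector_scaleR: "C *v (r *\<^sub>R x) = r *\<^sub>R (C *v x)" for x :: "complex ^ 'n"
  by (rule linear_scale[OF matrix_vector_mul_linear])

lemma cdot_commute: "cdot y x = cnj (cdot x y)"
  by (simp add: cdot_def mult.commute)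

lemma matrix_diff_ldistrib: "C ** (D - E) = C ** D - C ** (E :: complex ^ 'k ^ 'm)"
  by (simp add: vec_eq_iff matrix_matrix_mult_def right_diff_distrib sum_subtractf)

lemma matrix_add_rdistrib: "(D + E) ** C = D ** C + E ** (C :: complex ^ 'k ^ 'm)"
  by (simp add: vec_eq_iff matrix_matrix_mult_def distrib_right sum.distrib)

lemma matrix_diff_rdistrib: "(D - E) ** C = D ** C - E ** (C :: complex ^ 'k ^ 'm)"
  by (simp add: vec_eq_iff matrix_matrix_mult_def left_diff_distrib sum_subtractf)

lemma invertible_iff_ker:
  fixes C :: "complex ^ 'n ^ 'n"
  shows "invertible C \<longleftrightarrow> (\<forall>x. C *v x = 0 \<longrightarrow> x = 0)"
  by (simp add: invertible_left_inverse matrix_left_invertible_ker)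

lemma matrix_inv_mult:
  fixes C :: "complex ^ 'n ^ 'n"
  assumes "invertible C"
  shows matrix_inv_left: "matrix_inv C ** C = mat 1"
    and matrix_inv_right: "C ** matrix_inv C = mat 1"
proof -
  have "C ** matrix_inv C = mat 1 \<and> matrix_inv C ** C = mat 1"
    using assms unfolding matrix_inv_def invertible_def by (rule someI_ex)
  then show "matrix_inv C ** C = mat 1" "C ** matrix_inv C = mat 1" by auto
qed

lemma invertible_matrix_inv:
  fixes C :: "complex ^ 'n ^ 'n"
  shows "invertible C \<Longrightarrow> invertible (matrix_inv C)"
  using matrix_inv_mult[of C] unfolding invertible_def by blast

lemma ctranspose_matrix_inv_mult:
  fixes C :: "complex ^ 'n ^ 'n"
  assumes "invertible C"
  shows "ctranspose (matrix_inv C) ** ctranspose C = mat 1"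
    and "ctranspose C ** ctranspose (matrix_inv C) = mat 1"
  using matrix_inv_mult[OF assms] by (simp_all flip: ctranspose_mult)

lemma invertible_ctranspose:
  fixes C :: "complex ^ 'n ^ 'n"
  shows "invertible C \<Longrightarrow> invertible (ctranspose C)"
  using ctranspose_matrix_inv_mult[of C] unfolding invertible_def by blast

lemma full_column_rank_ker:
  fixes R :: "complex ^ 'm ^ 'n"
  assumes "rank R = CARD('m)" and "R *v x = 0"
  shows "x = 0"
proof -
  have "vec.span (rows R) = UNIV"
    using assms(1) by (simp add: row_rank_def_gen card_cart_basis vec.dimension_def flip: vec.dim_eq_full)
  then show ?thesis
    using assms(2) by (metis matrix_left_invertible_span_rows_gen matrix_left_invertible_ker)
qed

lemma rank_deficient_ker:
  fixes C :: "complex ^ 'n ^ 'n"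
  assumes "vec.dim (range ((*v) C)) < CARD('n)"
  shows "\<exists>y. y \<noteq> 0 \<and> C *v y = 0"
proof (rule ccontr)
  assume "\<not> ?thesis"
  then have "inj ((*v) C)"
    by (auto simp: vec.inj_iff_eq_0)
  then have "surj ((*v) C)"
    by (intro vec.linear_inj_imp_surj) simp_all
  then have "vec.dim (range ((*v) C)) = CARD('n)"
    using vec_dim_card[where ?'a = complex and ?'n = 'n] by metis
  then show False using assms by simp
qed

lemma matpow_commute:
  assumes "C ** D = D ** C"
  shows "matpow C k ** D = D ** matpow C k"
proof (induction k)
  case (Suc k)
  then show ?case using assms by (metis matpow.simps(2) matrix_mul_assoc)
qed simp

lemma matpow_mult_distrib:
  assumes "C ** D = D ** C"
  shows "matpow (C ** D) k = matpow C k ** matpow D k"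
proof (induction k)
  case (Suc k)
  have "matpow (C ** D) (Suc k) = C ** (D ** matpow C k) ** matpow D k"
    by (simp add: Suc matrix_mul_assoc)
  also have "\<dots> = matpow C (Suc k) ** matpow D (Suc k)"
    by (simp add: matrix_mul_assoc flip: matpow_commute[OF assms])
  finally show ?case .
qed simp

lemma invertible_matpow: "invertible C \<Longrightarrow> invertible (matpow C k)"
  by (induction k) (auto simp: invertible_mult invertible_iff_ker[of "mat 1"])

section \<open>The real inner product of a Hermitian positive definite matrix\<close>

text \<open>For Hermitian \<open>B\<close> the real part makes this a symmetric form over the reals, which agrees with the
  Hermitian form on the diagonal. All orthogonality that matters below holds for the complex form
  and passes to the real part.\<close>

definition bform :: "complex ^ 'n ^ 'n \<Rightarrow> complex ^ 'n \<Rightarrow> complex ^ 'n \<Rightarrow> real" where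
  "bform B x y = Re (cdot x (B *v y))"

lemma qform_eq_bform: "qform B x = bform B x x"
  by (simp add: qform_def bform_def)

lemma bform_simps [simp]:
  "bform B 0 y = 0" "bform B x 0 = 0"
  "bform B (x + x') y = bform B x y + bform B x' y"
  "bform B x (y + y') = bform B x y + bform B x y'"
  "bform B (x - x') y = bform B x y - bform B x' y"
  "bform B x (y - y') = bform B x y - bform B x y'"
  "bform B (r *\<^sub>R x) y = r * bform B x y" "bform B x (r *\<^sub>R y) = r * bform B x y"
  by (simp_all add: bform_def matrix_vector_right_distrib matrix_vector_mult_diff_distrib
      matrix_vector_scaleR)

lemma bform_commute: "hpd B \<Longrightarrow> bform B x y = bform B y x"
  unfolding bform_def hpd_def by (metis cdot_mult_right cdot_commute cnj.simps(1))

lemma bform_pos: "hpd B \<Longrightarrow> x \<noteq> 0 \<Longrightarrow> 0 < bform B x x"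
  by (simp add: hpd_def qform_eq_bform)

lemma bform_nonneg: "hpd B \<Longrightarrow> 0 \<le> bform B x x"
  by (cases "x = 0") (auto dest: bform_pos intro: less_imp_le)

text \<open>The square length of \<open>\<langle>y, y\<rangle> x - \<langle>x, y\<rangle> y\<close> is nonnegative.\<close>

lemma bform_Cauchy_Schwarz:
  assumes "hpd B"
  shows "(bform B x y)\<^sup>2 \<le> bform B x x * bform B y y"
proof (cases "y = 0")
  case False
  define a where "a = bform B y y"
  define b where "b = bform B x y"
  have a: "a > 0" unfolding a_def by (rule bform_pos[OF assms False])
  have "0 \<le> bform B (a *\<^sub>R x - b *\<^sub>R y) (a *\<^sub>R x - b *\<^sub>R y)"
    by (rule bform_nonneg[OF assms])
  also have "\<dots> = a * (a * bform B x x - b\<^sup>2)"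
    using bform_commute[OF assms, of y x]
    by (simp add: algebra_simps power2_eq_square flip: a_def b_def)
  finally have "0 \<le> a * bform B x x - b\<^sup>2"
    using a by (simp add: zero_le_mult_iff)
  then show ?thesis by (simp add: a_def b_def mult.commute)
qed simp

lemma hpd_invertible: "hpd B \<Longrightarrow> invertible B"
  unfolding invertible_iff_ker using bform_pos[of B] by (metis bform_def cdot_simps(2) less_irrefl zero_complex.sel(1))

lemma bform_badjoint:
  assumes "hpd B"
  shows "bform B x (C *v y) = bform B (badjoint B C *v x) y"
proof -
  have B: "ctranspose B = B" using assms by (simp add: hpd_def)
  have "ctranspose (badjoint B C) ** B = B ** C ** (ctranspose (matrix_inv B) ** ctranspose B)"
    by (simp add: badjoint_def ctranspose_mult matrix_mul_assoc B)
  also have "\<dots> = B ** C"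
    by (simp add: ctranspose_matrix_inv_mult hpd_invertible assms)
  finally have "ctranspose (badjoint B C) ** B = B ** C" .
  then show ?thesis
    unfolding bform_def cdot_mult_right[of _ "badjoint B C"]
    by (metis cdot_mult_right ctranspose_ctranspose matrix_vector_mul_assoc)
qed

lemma bform_badjoint':
  "hpd B \<Longrightarrow> bform B (C *v x) y = bform B x (badjoint B C *v y)"
  by (metis bform_badjoint bform_commute)

lemma badjoint_mult:
  assumes "hpd B"
  shows "badjoint B (C ** D) = badjoint B D ** badjoint B C"
proof -
  have "badjoint B D ** badjoint B C
      = matrix_inv B ** ctranspose D ** (B ** matrix_inv B) ** ctranspose C ** B"
    by (simp add: badjoint_def matrix_mul_assoc)
  then show ?thesis
    by (simp add: matrix_inv_right hpd_invertible assms badjoint_def ctranspose_mult matrix_mul_assoc)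
qed

lemma badjoint_mat_1: "hpd B \<Longrightarrow> badjoint B (mat 1) = mat 1"
  by (simp add: badjoint_def matrix_inv_left hpd_invertible)

lemma badjoint_diff: "badjoint B (C - D) = badjoint B C - badjoint B D"
  by (simp add: badjoint_def ctranspose_diff matrix_diff_ldistrib matrix_diff_rdistrib)

lemma badjoint_matpow: "hpd B \<Longrightarrow> badjoint B (matpow C k) = matpow (badjoint B C) k"
  by (induction k) (simp_all add: badjoint_mat_1 badjoint_mult matpow_commute)

lemma badjoint_badjoint:
  assumes "hpd B"
  shows "badjoint B (badjoint B C) = C"
proof -
  have B: "ctranspose B = B" using assms by (simp add: hpd_def)
  have "badjoint B (badjoint B C)
      = (matrix_inv B ** B) ** C ** (ctranspose (matrix_inv B) ** ctranspose B)"
    by (simp add: badjoint_def ctranspose_mult matrix_mul_assoc B)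
  then show ?thesis
    by (simp add: ctranspose_matrix_inv_mult matrix_inv_left hpd_invertible assms)
qed

lemma bnormal_one_minus:
  assumes "hpd B" "bnormal B X"
  shows "bnormal B (mat 1 - X)"
  using assms
  by (simp add: bnormal_def badjoint_diff badjoint_mat_1 matrix_diff_ldistrib matrix_diff_rdistrib)

lemma bnormal_matpow:
  assumes "hpd B" "bnormal B C"
  shows "bnormal B (matpow C k)"
  using assms unfolding bnormal_def badjoint_matpow[OF assms(1)]
  by (metis matpow_commute)

text \<open>Both sides are the quadratic form at \<open>y\<close> of the common value of \<open>T\<^sup>+ T\<close> and \<open>T T\<^sup>+\<close>.\<close>

lemma bnormal_norm_eq:
  assumes "hpd B" "bnormal B T"
  shows "bform B (T *v y) (T *v y) = bform B (badjoint B T *v y) (badjoint B T *v y)"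
proof -
  have "bform B (T *v y) (T *v y) = bform B y ((badjoint B T ** T) *v y)"
    by (simp add: bform_badjoint'[OF assms(1)] matrix_vector_mul_assoc)
  also have "\<dots> = bform B y ((T ** badjoint B T) *v y)"
    using assms(2) by (simp add: bnormal_def)
  also have "\<dots> = bform B (badjoint B T *v y) (badjoint B T *v y)"
    by (simp add: bform_badjoint[OF assms(1)] flip: matrix_vector_mul_assoc)
  finally show ?thesis .
qed

section \<open>Extremal vectors and the operator norm\<close>

lemma continuous_on_bform: "continuous_on S (\<lambda>v. bform B v v)"
proof -
  have "continuous_on S (\<lambda>v. B *v v)"
    by (rule linear_continuous_on_compose[OF continuous_on_id matrix_vector_mul_linear])
  then show ?thesis
    unfolding bform_def cdot_def
    by (intro continuous_intros)
qed

text \<open>The quotient is unchanged when \<open>y\<close> is scaled, so it suffices to maximise it on the Euclidean unit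
  sphere of the subspace \<open>ker L\<close>, which is compact. Taking \<open>L = 0\<close> and the form of \<open>C\<^sup>H B C\<close> gives the
  boundedness needed for \<open>bnorm B C\<close> to be a meaningful supremum.\<close>

lemma rayleigh_quotient_attains_max:
  fixes B F :: "complex ^ 'n ^ 'n" and L :: "complex ^ 'n ^ 'k"
  assumes B: "hpd B" and ex: "\<exists>y. y \<noteq> 0 \<and> L *v y = 0"
  obtains v \<mu> where "v \<noteq> 0" "L *v v = 0" "bform F v v = \<mu> * bform B v v"
    "\<And>y. L *v y = 0 \<Longrightarrow> bform F y y \<le> \<mu> * bform B y y"
proof -
  define S where "S = {y. L *v y = 0} \<inter> sphere 0 1"
  define q where "q y = bform F y y / bform B y y" for y
  have "closed {y. L *v y = 0}"
    by (intro closed_Collect_eq continuous_on_const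
        linear_continuous_on_compose[OF continuous_on_id matrix_vector_mul_linear])
  then have "compact S" unfolding S_def by (simp add: closed_Int_compact)
  obtain y where y: "y \<noteq> 0" "L *v y = 0" using ex by blast
  have "(1 / norm y) *\<^sub>R y \<in> S"
    using y by (simp add: S_def matrix_vector_scaleR)
  then have "S \<noteq> {}" by blast
  have "bform B w w \<noteq> 0" if "w \<in> S" for w
    using bform_pos[OF B, of w] that by (force simp: S_def)
  then have "continuous_on S q"
    unfolding q_def by (intro continuous_intros continuous_on_bform) auto
  from continuous_attains_sup[OF \<open>compact S\<close> \<open>S \<noteq> {}\<close> this]
  obtain v where v: "v \<in> S" "\<And>w. w \<in> S \<Longrightarrow> q w \<le> q v" by blast
  have "v \<noteq> 0" using v(1) by (auto simp: S_def)
  show thesis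
  proof (rule that[of v "q v"])
    show "bform F y y \<le> q v * bform B y y" if "L *v y = 0" for y
    proof (cases "y = 0")
      case False
      define w where "w = (1 / norm y) *\<^sub>R y"
      have "w \<in> S"
        using that False by (simp add: w_def S_def matrix_vector_scaleR)
      moreover have "q w = q y"
        using False by (simp add: q_def w_def)
      ultimately have "q y \<le> q v" using v(2) by force
      then show ?thesis
        using bform_pos[OF B False] by (simp add: q_def field_simps)
    qed simp
    show "bform F v v = q v * bform B v v"
      using bform_pos[OF B \<open>v \<noteq> 0\<close>] by (simp add: q_def)
  qed (use v \<open>v \<noteq> 0\<close> in \<open>auto simp: S_def\<close>)
qed

lemma bform_congruence:
  "bform (ctranspose C ** B ** C) x y = bform B (C *v x) (C *v y)"
  by (simp add: bform_def cdot_mult_right[of _ "ctranspose C"] flip: matrix_vector_mul_assoc)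

lemma bnorm_vec_eq: "bnorm_vec B x = sqrt (bform B x x)"
  by (simp add: bnorm_vec_def qform_eq_bform)

lemma bnorm_vec_pos: "hpd B \<Longrightarrow> x \<noteq> 0 \<Longrightarrow> 0 < bnorm_vec B x"
  by (simp add: bnorm_vec_eq bform_pos)

lemma bnorm_vec_power2: "hpd B \<Longrightarrow> (bnorm_vec B x)\<^sup>2 = bform B x x"
  by (simp add: bnorm_vec_eq bform_nonneg)

lemma bnorm_vec_nonneg: "hpd B \<Longrightarrow> 0 \<le> bnorm_vec B x"
  by (simp add: bnorm_vec_eq bform_nonneg)

lemma bnorm_vec_0 [simp]: "bnorm_vec B 0 = 0"
  by (simp add: bnorm_vec_eq)

lemma bform_le_bnorm_vec: "hpd B \<Longrightarrow> bform B x y \<le> bnorm_vec B x * bnorm_vec B y"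
  using real_sqrt_le_mono[OF bform_Cauchy_Schwarz[of B x y]]
  by (simp add: bnorm_vec_eq real_sqrt_mult)

lemma ex_nonzero_vec: "\<exists>x :: complex ^ 'n. x \<noteq> 0"
  by (rule exI[of _ "\<chi> i. 1"]) (simp add: vec_eq_iff)

text \<open>The supremum in \<open>bnorm\<close> is taken in the reals, so it dominates the quotients only once they
  are known to be bounded above.\<close>

lemma bnorm_vec_mult_le_bnorm:
  fixes B :: "complex ^ 'n ^ 'n"
  assumes "hpd B"
  shows "bnorm_vec B (C *v x) \<le> bnorm B C * bnorm_vec B x"
proof (cases "x = 0")
  case False
  obtain \<mu> where \<mu>: "bform B (C *v y) (C *v y) \<le> \<mu> * bform B y y" for y
    using rayleigh_quotient_attains_max[OF assms, of "0 :: complex ^ 'n ^ 'n" "ctranspose C ** B ** C"]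
      ex_nonzero_vec by (auto simp: bform_congruence)
  have "bdd_above ((\<lambda>x. bnorm_vec B (C *v x) / bnorm_vec B x) ` {x. x \<noteq> 0})"
  proof (rule bdd_aboveI2)
    fix y :: "complex ^ 'n" assume "y \<in> {x. x \<noteq> 0}"
    then have "0 < bnorm_vec B y" by (simp add: bnorm_vec_pos assms)
    moreover have "bnorm_vec B (C *v y) \<le> sqrt \<mu> * bnorm_vec B y"
      using \<mu>[of y] by (simp add: bnorm_vec_eq flip: real_sqrt_mult)
    ultimately show "bnorm_vec B (C *v y) / bnorm_vec B y \<le> sqrt \<mu>"
      by (simp add: field_simps)
  qed
  then have "bnorm_vec B (C *v x) / bnorm_vec B x \<le> bnorm B C"
    unfolding bnorm_def using False by (intro cSUP_upper) auto
  then show ?thesis using bnorm_vec_pos[OF assms False] by (simp add: field_simps)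
qed simp

lemma bnorm_le:
  fixes B :: "complex ^ 'n ^ 'n"
  assumes "hpd B" "\<And>x. bnorm_vec B (C *v x) \<le> c * bnorm_vec B x"
  shows "bnorm B C \<le> c"
  unfolding bnorm_def
proof (rule cSUP_least)
  show "{x :: complex ^ 'n. x \<noteq> 0} \<noteq> {}" using ex_nonzero_vec by auto
  fix x :: "complex ^ 'n" assume "x \<in> {x. x \<noteq> 0}"
  then show "bnorm_vec B (C *v x) / bnorm_vec B x \<le> c"
    using assms(2)[of x] bnorm_vec_pos[OF assms(1), of x] by (simp add: field_simps)
qed

lemma bnorm_nonneg:
  fixes B :: "complex ^ 'n ^ 'n"
  assumes "hpd B"
  shows "0 \<le> bnorm B C"
proof -
  obtain x :: "complex ^ 'n" where "x \<noteq> 0" using ex_nonzero_vec by blast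
  then have "0 < bnorm_vec B x" by (rule bnorm_vec_pos[OF assms])
  moreover have "0 \<le> bnorm B C * bnorm_vec B x"
    using bnorm_vec_mult_le_bnorm[OF assms, of C x] bnorm_vec_nonneg[OF assms, of "C *v x"] by linarith
  ultimately show ?thesis by (simp add: zero_le_mult_iff)
qed

lemma bnorm_mult_le:
  assumes "hpd B"
  shows "bnorm B (C ** D) \<le> bnorm B C * bnorm B D"
proof (rule bnorm_le[OF assms])
  fix x
  have "bnorm_vec B (C *v (D *v x)) \<le> bnorm B C * bnorm_vec B (D *v x)"
    by (rule bnorm_vec_mult_le_bnorm[OF assms])
  also have "\<dots> \<le> bnorm B C * (bnorm B D * bnorm_vec B x)"
    by (intro mult_left_mono bnorm_vec_mult_le_bnorm bnorm_nonneg assms)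
  finally show "bnorm_vec B ((C ** D) *v x) \<le> bnorm B C * bnorm B D * bnorm_vec B x"
    by (simp add: matrix_vector_mul_assoc mult.assoc)
qed

text \<open>\<open>\<parallel>C x\<parallel>\<^sup>2 = \<langle>x, C\<^sup>+ C x\<rangle> \<le> \<parallel>x\<parallel> \<parallel>C\<^sup>+ C x\<parallel>\<close>.\<close>

lemma bnorm_power2_le_badjoint_mult:
  assumes "hpd B"
  shows "(bnorm B C)\<^sup>2 \<le> bnorm B (badjoint B C ** C)"
proof -
  let ?c = "bnorm B (badjoint B C ** C)"
  have "bnorm B C \<le> sqrt ?c"
  proof (rule bnorm_le[OF assms])
    fix x
    have "bform B (C *v x) (C *v x) = bform B x ((badjoint B C ** C) *v x)"
      by (simp add: bform_badjoint'[OF assms] matrix_vector_mul_assoc)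
    also have "\<dots> \<le> bnorm_vec B x * bnorm_vec B ((badjoint B C ** C) *v x)"
      by (rule bform_le_bnorm_vec[OF assms])
    also have "\<dots> \<le> bnorm_vec B x * (?c * bnorm_vec B x)"
      by (intro mult_left_mono bnorm_vec_mult_le_bnorm bnorm_vec_nonneg assms)
    also have "\<dots> = ?c * bform B x x"
      by (simp add: power2_eq_square flip: bnorm_vec_power2[OF assms])
    finally show "bnorm_vec B (C *v x) \<le> sqrt ?c * bnorm_vec B x"
      by (simp add: bnorm_vec_eq flip: real_sqrt_mult)
  qed
  then have "(bnorm B C)\<^sup>2 \<le> (sqrt ?c)\<^sup>2"
    by (intro power_mono bnorm_nonneg assms)
  then show ?thesis by (simp add: bnorm_nonneg[OF assms])
qed

text \<open>Cancelling one factor \<open>\<parallel>C\<parallel>\<close> in \<open>\<parallel>C\<parallel>\<^sup>2 \<le> \<parallel>C\<^sup>+ C\<parallel> \<le> \<parallel>C\<^sup>+\<parallel> \<parallel>C\<parallel>\<close> gives one inequality, and the other is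
  the same for \<open>C\<^sup>+\<close>.\<close>

lemma bnorm_badjoint:
  assumes "hpd B"
  shows "bnorm B (badjoint B C) = bnorm B C"
proof -
  have le: "bnorm B D \<le> bnorm B (badjoint B D)" for D
  proof (cases "bnorm B D = 0")
    case False
    then have "0 < bnorm B D" using bnorm_nonneg[OF assms, of D] by simp
    moreover have "bnorm B D * bnorm B D \<le> bnorm B (badjoint B D) * bnorm B D"
      using bnorm_power2_le_badjoint_mult[OF assms, of D] bnorm_mult_le[OF assms, of "badjoint B D" D]
      by (simp add: power2_eq_square)
    ultimately show ?thesis by simp
  qed (simp add: bnorm_nonneg assms)
  show ?thesis using le[of C] le[of "badjoint B C"] by (simp add: badjoint_badjoint assms)
qed

lemma bnorm_badjoint_mult:
  assumes "hpd B"
  shows "bnorm B (badjoint B C ** C) = (bnorm B C)\<^sup>2"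
  using bnorm_power2_le_badjoint_mult[OF assms, of C] bnorm_mult_le[OF assms, of "badjoint B C" C]
  by (simp add: bnorm_badjoint assms power2_eq_square)

section \<open>Normal smoothers and orthogonal projections\<close>

lemma bnorm_normal_mult:
  assumes "hpd B" "bnormal B T"
  shows "bnorm B (T ** C) = bnorm B (badjoint B T ** C)"
  unfolding bnorm_def bnorm_vec_eq
  by (simp add: bnormal_norm_eq[OF assms] flip: matrix_vector_mul_assoc)

text \<open>Normality turns \<open>T Q\<close> into the adjoint of \<open>Q T\<close>. In \<open>T Q T\<close> the middle factor is read as
  \<open>Q Q\<close>, so that normality turns the product into \<open>C\<^sup>+ C\<close> with \<open>C = Q T\<close>.\<close>

lemma bnorm_normal_projection:
  assumes B: "hpd B" and T: "bnormal B T" and Q: "badjoint B Q = Q" "Q ** Q = Q"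
  shows "bnorm B (Q ** T) = bnorm B (T ** Q)"
    and "bnorm B (T ** Q ** T) = (bnorm B (T ** Q))\<^sup>2"
proof -
  have "bnorm B (Q ** T) = bnorm B (badjoint B (Q ** T))"
    by (simp add: bnorm_badjoint B)
  also have "\<dots> = bnorm B (T ** Q)"
    using bnorm_normal_mult[OF B T, of Q] by (simp add: badjoint_mult B Q)
  finally show QT: "bnorm B (Q ** T) = bnorm B (T ** Q)" .
  have "bnorm B (T ** Q ** T) = bnorm B (badjoint B T ** (Q ** T))"
    using bnorm_normal_mult[OF B T, of "Q ** T"] by (simp add: matrix_mul_assoc)
  also have "badjoint B T ** (Q ** T) = badjoint B (Q ** T) ** (Q ** T)"
    by (metis B Q badjoint_mult matrix_mul_assoc)
  finally show "bnorm B (T ** Q ** T) = (bnorm B (T ** Q))\<^sup>2"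
    by (simp add: bnorm_badjoint_mult B QT)
qed

text \<open>The first application of \<open>S\<close> strictly shortens \<open>y\<close>; the remaining ones do not lengthen it. Only
  the shortening at the nonzero vector \<open>y\<close> is strict, since a power of \<open>S\<close> may vanish at \<open>y\<close>.\<close>

lemma bnorm_matpow_strict_contraction:
  assumes B: "hpd B" and S: "bnorm B S < 1" and "y \<noteq> 0" "k \<ge> 1"
  shows "bform B (matpow S k *v y) (matpow S k *v y) < bform B y y"
proof -
  have less: "bnorm_vec B (S *v x) < bnorm_vec B x" if "x \<noteq> 0" for x
  proof -
    have "bnorm_vec B (S *v x) \<le> bnorm B S * bnorm_vec B x"
      by (rule bnorm_vec_mult_le_bnorm[OF B])
    also have "\<dots> < bnorm_vec B x" using S bnorm_vec_pos[OF B that] by simp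
    finally show ?thesis .
  qed
  have le: "bnorm_vec B (S *v x) \<le> bnorm_vec B x" for x
    using less[of x] by (cases "x = 0") auto
  have "bnorm_vec B (matpow S (Suc j) *v y) < bnorm_vec B y" for j
  proof (induction j)
    case 0
    then show ?case using less \<open>y \<noteq> 0\<close> by simp
  next
    case (Suc j)
    then show ?case
      using le[of "matpow S (Suc j) *v y"] by (simp add: matrix_vector_mul_assoc)
  qed
  from this[of "k - 1"] show ?thesis using \<open>k \<ge> 1\<close> by (simp add: bnorm_vec_eq)
qed

text \<open>\<open>Q\<close> maps into its fixed space without increasing lengths, so passing from all \<open>x\<close> to the fixed
  vectors \<open>Q x\<close> leaves the supremum of \<open>\<parallel>T Q x\<parallel> / \<parallel>x\<parallel>\<close> unchanged.\<close>

lemma bnorm_mult_projection: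
  assumes B: "hpd B" and Q: "badjoint B Q = Q" "Q ** Q = Q"
    and v: "v \<noteq> 0" "Q *v v = v" "bform B (T *v v) (T *v v) = \<mu> * bform B v v"
    and max: "\<And>y. Q *v y = y \<Longrightarrow> bform B (T *v y) (T *v y) \<le> \<mu> * bform B y y"
  shows "(bnorm B (T ** Q))\<^sup>2 = \<mu>"
proof (rule antisym)
  have "0 \<le> \<mu> * bform B v v" using bform_nonneg[OF B, of "T *v v"] v by simp
  then have \<mu>: "0 \<le> \<mu>" using bform_pos[OF B v(1)] by (simp add: zero_le_mult_iff)
  have contr: "bform B (Q *v x) (Q *v x) \<le> bform B x x" for x
  proof -
    have "0 \<le> bform B (x - Q *v x) (x - Q *v x)" by (rule bform_nonneg[OF B])
    moreover have "bform B (Q *v x) (Q *v x) = bform B x (Q *v x)"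
      by (simp add: bform_badjoint'[OF B] Q matrix_vector_mul_assoc)
    ultimately show ?thesis using bform_commute[OF B, of x "Q *v x"] by simp
  qed
  have "bnorm B (T ** Q) \<le> sqrt \<mu>"
  proof (rule bnorm_le[OF B])
    fix x
    have "bform B (T *v (Q *v x)) (T *v (Q *v x)) \<le> \<mu> * bform B (Q *v x) (Q *v x)"
      by (rule max) (simp add: matrix_vector_mul_assoc Q)
    also have "\<dots> \<le> \<mu> * bform B x x" by (intro mult_left_mono contr \<mu>)
    finally show "bnorm_vec B ((T ** Q) *v x) \<le> sqrt \<mu> * bnorm_vec B x"
      by (simp add: bnorm_vec_eq flip: real_sqrt_mult matrix_vector_mul_assoc)
  qed
  then show "(bnorm B (T ** Q))\<^sup>2 \<le> \<mu>"
    using power_mono[OF _ bnorm_nonneg[OF B], of "T ** Q" "sqrt \<mu>" 2] \<mu> by simp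
  have "(bnorm_vec B (T *v v))\<^sup>2 \<le> (bnorm B (T ** Q) * bnorm_vec B v)\<^sup>2"
    using bnorm_vec_mult_le_bnorm[OF B, of "T ** Q" v] v(2)
    by (intro power_mono bnorm_vec_nonneg B) (simp flip: matrix_vector_mul_assoc)
  then show "\<mu> \<le> (bnorm B (T ** Q))\<^sup>2"
    using bform_pos[OF B v(1)] by (simp add: power_mult_distrib bnorm_vec_power2 B v(3))
qed

section \<open>The approximation constant of the coarse space\<close>

text \<open>Self-adjointness of \<open>W\<close> says that \<open>B W = W\<^sup>H B\<close>; multiplying by \<open>W\<^sup>-\<^sup>H\<close> on the left and \<open>W\<^sup>-\<^sup>1\<close> on the
  right gives \<open>W\<^sup>-\<^sup>H B = B W\<^sup>-\<^sup>1\<close>, which is the Hermitian symmetry of \<open>B W\<^sup>-\<^sup>1\<close>. At \<open>v = W y\<close> its quadratic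
  form has the value \<open>\<langle>y, W y\<rangle>\<close>.\<close>

lemma hpd_mult_matrix_inv:
  assumes B: "hpd B" and W: "badjoint B W = W" "\<And>y. y \<noteq> 0 \<Longrightarrow> 0 < bform B y (W *v y)"
  shows "invertible W" and "hpd (B ** matrix_inv W)"
proof -
  show inv: "invertible W"
    unfolding invertible_iff_ker using W(2) by (metis bform_simps(2) less_irrefl)
  note WW = matrix_inv_mult[OF inv]
  have Bh: "ctranspose B = B" using B by (simp add: hpd_def)
  have "B ** W = (B ** matrix_inv B) ** ctranspose W ** B"
    by (subst W(1)[symmetric]) (simp add: badjoint_def matrix_mul_assoc)
  then have "B ** W = ctranspose W ** B"
    by (simp add: matrix_inv_right hpd_invertible B)
  then have "ctranspose (matrix_inv W) ** (B ** W) ** matrix_inv W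
      = (ctranspose (matrix_inv W) ** ctranspose W) ** B ** matrix_inv W"
    by (simp add: matrix_mul_assoc)
  then have "ctranspose (matrix_inv W) ** B ** (W ** matrix_inv W) = B ** matrix_inv W"
    by (simp add: ctranspose_matrix_inv_mult inv matrix_mul_assoc)
  then have "ctranspose (B ** matrix_inv W) = B ** matrix_inv W"
    by (simp add: WW ctranspose_mult Bh)
  moreover have "0 < qform (B ** matrix_inv W) v" if "v \<noteq> 0" for v
  proof -
    define y where "y = matrix_inv W *v v"
    have v: "v = W *v y" by (simp add: y_def matrix_vector_mul_assoc WW)
    then have "y \<noteq> 0" using that by auto
    have "qform (B ** matrix_inv W) v = bform B v y"
      by (simp add: qform_eq_bform bform_def y_def matrix_vector_mul_assoc)
    also have "\<dots> = bform B y (W *v y)"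
      using bform_commute[OF B] v by simp
    finally show ?thesis using W(2)[OF \<open>y \<noteq> 0\<close>] by simp
  qed
  ultimately show "hpd (B ** matrix_inv W)" by (simp add: hpd_def)
qed

lemma hpd_congruence:
  fixes P :: "complex ^ 'm ^ 'n"
  assumes "hpd G" "\<And>x. P *v x = 0 \<Longrightarrow> x = 0"
  shows "hpd (ctranspose P ** G ** P)"
  unfolding hpd_def qform_eq_bform bform_congruence
  using assms by (auto simp: ctranspose_mult hpd_def matrix_mul_assoc qform_eq_bform)

text \<open>Put \<open>G = B W\<^sup>-\<^sup>1\<close> and let \<open>Pr\<close> be the \<open>G\<close>-orthogonal projection onto the range of \<open>P\<close>. For any \<open>v\<close>
  write \<open>v - Pr v = W y\<close>. Then \<open>G (v - Pr v) = B y\<close>, so \<open>y\<close> is \<open>B\<close>-orthogonal to the range of \<open>P\<close>, and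
  the numerator of the quotient in \<open>Kconst\<close> is \<open>k = \<langle>v, y\<rangle> = \<langle>y, W y\<rangle>\<close>.

  Cauchy-Schwarz for \<open>B\<close> gives \<open>k\<^sup>2 \<le> \<parallel>v\<parallel>\<^sup>2 \<parallel>y\<parallel>\<^sup>2 \<le> \<parallel>v\<parallel>\<^sup>2 k / \<rho>\<close>, that is \<open>k \<le> \<parallel>v\<parallel>\<^sup>2 / \<rho>\<close>.
  The bound is attained at the minimiser \<open>v = y0\<close>: the \<open>G\<close>-product of \<open>W y0\<close> and \<open>W y\<close> is \<open>\<parallel>y0\<parallel>\<^sup>2\<close>, while
  their squared \<open>G\<close>-lengths are \<open>\<rho> \<parallel>y0\<parallel>\<^sup>2\<close> and \<open>k\<close>, so Cauchy-Schwarz for \<open>G\<close> gives the reverse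
  inequality.\<close>

lemma Kconst_eq_inverse_min:
  fixes B W :: "complex ^ 'n ^ 'n" and P :: "complex ^ 'm ^ 'n"
  assumes B: "hpd B" and W: "badjoint B W = W" "\<And>y. y \<noteq> 0 \<Longrightarrow> 0 < bform B y (W *v y)"
    and P: "\<And>x. P *v x = 0 \<Longrightarrow> x = 0"
    and y0: "y0 \<noteq> 0" "ctranspose P *v (B *v y0) = 0" "bform B y0 (W *v y0) = \<rho> * bform B y0 y0"
    and min: "\<And>y. ctranspose P *v (B *v y) = 0 \<Longrightarrow> \<rho> * bform B y y \<le> bform B y (W *v y)"
  shows "Kconst (B ** matrix_inv W) B P = 1 / \<rho>"
proof -
  define G where "G = B ** matrix_inv W"
  note inv = matrix_inv_mult[OF hpd_mult_matrix_inv(1)[OF B W]]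
  have G: "hpd G" unfolding G_def by (rule hpd_mult_matrix_inv(2)[OF B W])
  have GW: "G *v (W *v y) = B *v y" for y
    by (simp add: G_def matrix_vector_mul_assoc inv flip: matrix_mul_assoc)
  define J where "J = ctranspose P ** G ** P"
  have J: "J ** matrix_inv J = mat 1"
    unfolding J_def by (intro matrix_inv_right hpd_invertible hpd_congruence G P)
  define Pr where "Pr = P ** matrix_inv J ** ctranspose P ** G"
  define y where "y v = matrix_inv W *v (v - Pr *v v)" for v
  have Wy: "W *v y v = v - Pr *v v" for v
    by (simp add: y_def matrix_vector_mul_assoc inv)
  have "ctranspose P ** G ** Pr = (J ** matrix_inv J) ** ctranspose P ** G"
    by (simp add: Pr_def J_def matrix_mul_assoc)
  then have PG: "ctranspose P ** G ** Pr = ctranspose P ** G" by (simp add: J)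
  have yP: "ctranspose P *v (B *v y v) = 0" for v
  proof -
    have "ctranspose P *v (B *v y v) = ctranspose P *v (G *v (v - Pr *v v))"
      by (simp add: Wy flip: GW)
    also have "\<dots> = 0"
      by (simp add: matrix_vector_mult_diff_distrib matrix_vector_mul_assoc matrix_mul_assoc PG)
    finally show ?thesis .
  qed
  \<comment> \<open>The \<open>B\<close>-complement of the range of \<open>P\<close> is described by the equation \<open>P\<^sup>H B z = 0\<close>.\<close>
  have orth: "bform B (P *v a) z = 0" if "ctranspose P *v (B *v z) = 0" for a z
    using cdot_mult_right[of a "ctranspose P" "B *v z"] that by (simp add: bform_def)
  have PrP: "Pr *v v = P *v (matrix_inv J *v (ctranspose P *v (G *v v)))" for v
    by (simp add: Pr_def matrix_vector_mul_assoc matrix_mul_assoc)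
  have q: "qform (G ** (mat 1 - Pr)) v = bform B v (y v)" for v
    by (simp add: qform_eq_bform bform_def matrix_vector_mult_diff_rdistrib Wy
        flip: matrix_vector_mul_assoc GW)
  have q': "bform B v (y v) = bform B (y v) (W *v y v)" for v
  proof -
    have "bform B (y v) (W *v y v) = bform B (W *v y v) (y v)" by (rule bform_commute[OF B])
    then show ?thesis by (simp add: Wy orth[OF yP] PrP)
  qed
  have \<rho>: "0 < \<rho>"
    using W(2)[OF y0(1)] bform_pos[OF B y0(1)] by (simp add: y0(3) zero_less_mult_iff)
  have bound: "bform B v (y v) \<le> bform B v v / \<rho>" for v
  proof -
    define k where "k = bform B v (y v)"
    have "\<rho> * k\<^sup>2 \<le> \<rho> * (bform B v v * bform B (y v) (y v))"
      unfolding k_def using \<rho> by (intro mult_left_mono bform_Cauchy_Schwarz B) simp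
    also have "\<dots> = bform B v v * (\<rho> * bform B (y v) (y v))" by simp
    also have "\<dots> \<le> bform B v v * k"
      using min[OF yP, of v] by (intro mult_left_mono bform_nonneg B) (simp add: k_def q')
    finally have "k * (\<rho> * k) \<le> k * bform B v v" by (simp add: power2_eq_square mult_ac)
    moreover have "0 \<le> k"
      unfolding k_def q' using W(2)[of "y v"] by (cases "y v = 0") auto
    ultimately have "\<rho> * k \<le> bform B v v"
      using bform_nonneg[OF B, of v] by (cases "k = 0") auto
    then show ?thesis using \<rho> by (simp add: k_def field_simps)
  qed
  have attained: "bform B y0 (y y0) = bform B y0 y0 / \<rho>"
  proof (rule antisym[OF bound])
    define b where "b = bform B y0 y0"
    have b: "b > 0" unfolding b_def by (rule bform_pos[OF B y0(1)])
    have form_G: "bform G a (W *v z) = bform B a z" for a z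
      by (simp add: bform_def GW)
    have "bform B (W *v y0) (y y0) = bform B y0 (W *v y y0)"
      using bform_badjoint'[OF B, of W] by (simp add: W)
    also have "\<dots> = b"
      using bform_commute[OF B, of y0 "Pr *v y0"] by (simp add: Wy PrP orth[OF y0(2)] b_def)
    finally have "b\<^sup>2 = (bform G (W *v y0) (W *v y y0))\<^sup>2" by (simp add: form_G)
    also have "\<dots> \<le> bform G (W *v y0) (W *v y0) * bform G (W *v y y0) (W *v y y0)"
      by (rule bform_Cauchy_Schwarz[OF G])
    also have "\<dots> = (\<rho> * b) * bform B y0 (y y0)"
      using y0(3) bform_commute[OF B] by (simp add: form_G b_def q')
    finally have "b \<le> \<rho> * bform B y0 (y y0)"
      using b by (simp add: power2_eq_square mult_ac)
    then show "bform B y0 y0 / \<rho> \<le> bform B y0 (y y0)"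
      using \<rho> by (simp add: b_def field_simps)
  qed
  have "Kconst G B P = (GREATEST k. k \<in> {bform B v (y v) / bform B v v | v. v \<noteq> 0})"
    unfolding Kconst_def q[unfolded Pr_def J_def] qform_eq_bform[of B] ..
  also have "\<dots> = 1 / \<rho>"
  proof (rule Greatest_equality)
    show "1 / \<rho> \<in> {bform B v (y v) / bform B v v | v. v \<noteq> 0}"
      using y0(1) attained bform_pos[OF B y0(1)] by (auto intro!: exI[of _ y0])
    fix k assume "k \<in> {bform B v (y v) / bform B v v | v. v \<noteq> 0}"
    then obtain v where v: "v \<noteq> 0" "k = bform B v (y v) / bform B v v" by blast
    then show "k \<le> 1 / \<rho>"
      using divide_right_mono[OF bound[of v] bform_nonneg[OF B, of v]] bform_pos[OF B v(1)] by simp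
  qed
  finally show ?thesis by (simp add: G_def)
qed

section \<open>The two-grid error propagators\<close>

text \<open>With \<open>X = M\<^sup>-\<^sup>1 A\<close> the product of \<open>Mhat_inv\<close> and \<open>B\<close> is \<open>X + X\<^sup>+ - X X\<^sup>+\<close>, which is
  \<open>I - (I - X) (I - X\<^sup>+)\<close>.\<close>

lemma one_minus_Mhat_inv_mult:
  fixes A M B :: "complex ^ 'n ^ 'n"
  assumes B: "hpd B"
  shows "mat 1 - Mhat_inv A M B ** B = smoother A M ** badjoint B (smoother A M)"
proof -
  define X where "X = matrix_inv M ** A"
  define Y where "Y = badjoint B X"
  have Y: "Y = matrix_inv B ** ctranspose A ** ctranspose (matrix_inv M) ** B"
    by (simp add: Y_def X_def badjoint_def ctranspose_mult matrix_mul_assoc)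
  have "Mhat_inv A M B ** B = X ** (matrix_inv B ** B) + Y - X ** Y"
    by (simp add: Mhat_inv_def Y X_def matrix_mul_assoc matrix_add_rdistrib matrix_diff_rdistrib)
  then have "Mhat_inv A M B ** B = X + Y - X ** Y"
    by (simp add: matrix_inv_left hpd_invertible B)
  then show ?thesis
    by (simp add: smoother_def badjoint_diff badjoint_mat_1 B matrix_diff_ldistrib
        matrix_diff_rdistrib flip: X_def Y_def)
qed

theorem theorem3p17:
  fixes A M B :: "complex ^ 'n ^ 'n"
    and R :: "complex ^ 'm ^ 'n"
    and \<nu> :: nat
  assumes "invertible A"
    and "invertible M"
    and "hpd B"
    and "rank R = CARD('m)"
    and "bnorm B (mat 1 - matrix_inv M ** A) < 1"
    and "bnormal B (matrix_inv M ** A)"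
    and "invertible (mat 1 - matrix_inv M ** A)"
    and "cgproj A (Pstar A B R) R ** cgproj A (Pstar A B R) R = cgproj A (Pstar A B R) R"
    and "borthogonal B (cgproj A (Pstar A B R) R)"
    and "0 < vec.dim (range ((*v) (cgproj A (Pstar A B R) R)))"
    and "vec.dim (range ((*v) (cgproj A (Pstar A B R) R))) = CARD('m)"
    and "CARD('m) < CARD('n)"
    and "\<nu> \<ge> 1"
  shows "bnorm B (errprop A M B R \<nu> \<nu>) = (bnorm B (errprop A M B R \<nu> 0))\<^sup>2
    \<and> (bnorm B (errprop A M B R \<nu> 0))\<^sup>2 = (bnorm B (errprop A M B R 0 \<nu>))\<^sup>2
    \<and> (bnorm B (errprop A M B R 0 \<nu>))\<^sup>2 = 1 - 1 / Kconst (Xhat A M B \<nu>) B (Pstar A B R)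
    \<and> invertible (mat 1 - matpow (mat 1 - Mhat_inv A M B ** B) \<nu>)
    \<and> hpd (Xhat A M B \<nu>)
    \<and> 1 / Kconst (Xhat A M B \<nu>) B (Pstar A B R) \<in> {0<..<1}"
proof -
  note B = \<open>hpd B\<close>
  define S where "S = smoother A M"
  define T where "T = matpow S \<nu>"
  define P where "P = Pstar A B R"
  define Pr where "Pr = cgproj A P R"
  define Q where "Q = mat 1 - Pr"
  define W where "W = mat 1 - T ** badjoint B T"
  have S: "bnorm B S < 1" "bnormal B S" "invertible S"
    using assms(5-7) bnormal_one_minus[OF B] by (simp_all add: S_def smoother_def)
  have T: "bnormal B T" "invertible T"
    unfolding T_def using S bnormal_matpow[OF B] invertible_matpow by auto

  \<comment> \<open>The choice of \<open>P\<^sub>*\<close> makes \<open>R\<^sup>H A P\<^sub>*\<close> equal to the positive definite matrix \<open>P\<^sub>*\<^sup>H B P\<^sub>*\<close>.\<close>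
  have PB: "ctranspose P ** B = ctranspose R ** A"
  proof -
    have "ctranspose P ** B = ctranspose R ** A ** (ctranspose (matrix_inv B) ** ctranspose B)"
      using B by (simp add: P_def Pstar_def ctranspose_mult matrix_mul_assoc hpd_def)
    then show ?thesis by (simp add: ctranspose_matrix_inv_mult hpd_invertible B)
  qed
  have P_inj: "x = 0" if "P *v x = 0" for x
  proof -
    have "matrix_inv B *v (ctranspose A *v (R *v x)) = 0"
      using that by (simp add: P_def Pstar_def matrix_vector_mul_assoc matrix_mul_assoc)
    then have "R *v x = 0"
      using invertible_matrix_inv[OF hpd_invertible[OF B]] invertible_ctranspose[OF assms(1)]
      unfolding invertible_iff_ker by blast
    then show ?thesis using full_column_rank_ker assms(4) by blast
  qed
  define J where "J = ctranspose R ** A ** P"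
  have J: "J ** matrix_inv J = mat 1"
    unfolding J_def by (intro matrix_inv_right hpd_invertible)
      (simp only: hpd_congruence[OF B P_inj] flip: PB)
  have Pr_eq: "Pr = P ** matrix_inv J ** ctranspose R ** A"
    by (simp add: Pr_def cgproj_def J_def)
  have "ctranspose R ** A ** Pr = (J ** matrix_inv J) ** ctranspose R ** A"
    by (simp add: Pr_eq J_def matrix_mul_assoc)
  then have RAPr: "ctranspose R ** A ** Pr = ctranspose R ** A" by (simp add: J)
  \<comment> \<open>The kernel of the projection, which is the range of \<open>Q\<close>, is the \<open>B\<close>-complement of the range of \<open>P\<^sub>*\<close>.\<close>
  have ker: "Pr *v y = 0 \<longleftrightarrow> ctranspose P *v (B *v y) = 0" for y
  proof
    assume "Pr *v y = 0"
    then have "(ctranspose R ** A ** Pr) *v y = 0"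
      by (simp flip: matrix_vector_mul_assoc)
    then show "ctranspose P *v (B *v y) = 0"
      by (simp add: RAPr matrix_vector_mul_assoc PB)
  next
    assume "ctranspose P *v (B *v y) = 0"
    then have "(ctranspose R ** A) *v y = 0" by (simp add: matrix_vector_mul_assoc PB)
    moreover have "Pr *v y = (P ** matrix_inv J) *v ((ctranspose R ** A) *v y)"
      by (simp add: Pr_eq matrix_vector_mul_assoc matrix_mul_assoc)
    ultimately show "Pr *v y = 0" by simp
  qed
  have Q: "badjoint B Q = Q" "Q ** Q = Q"
    using assms(8,9)
    by (simp_all add: Q_def Pr_def P_def borthogonal_def badjoint_diff badjoint_mat_1 B
        matrix_diff_ldistrib matrix_diff_rdistrib)
  have Q_fix: "Q *v y = y \<longleftrightarrow> Pr *v y = 0" for y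
    by (simp add: Q_def matrix_vector_mult_diff_rdistrib)

  \<comment> \<open>\<open>n\<^sub>c < n\<close> is what makes the complement nontrivial, so that there is something to maximise over.\<close>
  obtain v \<mu> where v: "v \<noteq> 0" "Pr *v v = 0"
      "bform B (T *v v) (T *v v) = \<mu> * bform B v v"
    and max: "\<And>y. Pr *v y = 0 \<Longrightarrow> bform B (T *v y) (T *v y) \<le> \<mu> * bform B y y"
  proof (rule rayleigh_quotient_attains_max[OF B, of Pr "ctranspose T ** B ** T"])
    show "\<exists>y. y \<noteq> 0 \<and> Pr *v y = 0"
      using assms(11,12) by (intro rank_deficient_ker) (simp add: Pr_def P_def)
  qed (auto simp: bform_congruence)
  have TQ: "(bnorm B (T ** Q))\<^sup>2 = \<mu>"
    using v max by (intro bnorm_mult_projection[OF B Q]) (auto simp: Q_fix)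

  have less: "bform B (T *v y) (T *v y) < bform B y y" if "y \<noteq> 0" for y
    unfolding T_def by (rule bnorm_matpow_strict_contraction[OF B S(1) that \<open>\<nu> \<ge> 1\<close>])
  have W_form: "bform B y (W *v y) = bform B y y - bform B (T *v y) (T *v y)" for y
    by (simp add: W_def matrix_vector_mult_diff_rdistrib bnormal_norm_eq[OF B T(1)]
        bform_badjoint[OF B, of y T "badjoint B T *v y" for y] flip: matrix_vector_mul_assoc)
  have W: "badjoint B W = W" "\<And>y. y \<noteq> 0 \<Longrightarrow> 0 < bform B y (W *v y)"
    using less
    by (simp_all add: W_form)
       (simp add: W_def badjoint_diff badjoint_mat_1 badjoint_mult badjoint_badjoint B)
  have W_eq: "W = mat 1 - matpow (mat 1 - Mhat_inv A M B ** B) \<nu>"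
    using S(2) matpow_mult_distrib[of S "badjoint B S" \<nu>]
    by (simp add: W_def T_def badjoint_matpow B one_minus_Mhat_inv_mult bnormal_def flip: S_def)
  have Xhat: "Xhat A M B \<nu> = B ** matrix_inv W"
    by (simp add: Xhat_def W_eq)
  have K: "Kconst (Xhat A M B \<nu>) B P = 1 / (1 - \<mu>)"
    unfolding Xhat
  proof (rule Kconst_eq_inverse_min[OF B W P_inj v(1)])
    show "ctranspose P *v (B *v v) = 0" using v(2) ker by simp
    show "bform B v (W *v v) = (1 - \<mu>) * bform B v v"
      by (simp add: W_form v(3) algebra_simps)
    show "(1 - \<mu>) * bform B y y \<le> bform B y (W *v y)"
      if "ctranspose P *v (B *v y) = 0" for y
      using max[of y] that ker[of y] by (simp add: W_form algebra_simps)
  qed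

  have bv: "0 < bform B v v" by (rule bform_pos[OF B v(1)])
  have "\<mu> < 1" using less[OF v(1)] bv by (simp add: v(3))
  have "T *v v \<noteq> 0" using T(2) v(1) by (auto simp: invertible_iff_ker)
  then have "0 < \<mu>" using bform_pos[OF B, of "T *v v"] bv by (simp add: v(3) zero_less_mult_iff)

  have E: "errprop A M B R \<nu> \<nu> = T ** Q ** T" "errprop A M B R \<nu> 0 = Q ** T"
    "errprop A M B R 0 \<nu> = T ** Q"
    by (simp_all add: errprop_def T_def S_def Q_def Pr_def P_def)
  show ?thesis
    unfolding E bnorm_normal_projection[OF B T(1) Q] TQ K[unfolded P_def]
    using \<open>0 < \<mu>\<close> \<open>\<mu> < 1\<close> hpd_mult_matrix_inv[OF B W]
    by (simp add: Xhat flip: W_eq)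
qed

end
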